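(* Let $M$ be a complex manifold and let $g$ and $h$ be two Hermitian metrics on $M$ such that $HBC(g)\le -B_1$ and $HBC(h)\le -B_2$ for some positive constants $B_1$ and $B_2$. Then $$HBC(h+g)\le -C(g,h)^2B_1 - C(h,g)^2B_2 .$$
   Context: Curvature. For a Hermitian metric $h$ on a complex manifold $M$, with local expression $h_{i\bar j}$ in holomorphic coordinates $(z_1,\dots,z_n)$ and inverse matrix $h^{i\bar j}$, the curvature tensor $R_h$ is $$R_{i\bar j k\bar l} = -\frac{\partial^2 h_{i\bar j}}{\partial z_k\partial \bar z_l} + \sum_{s,t} h^{s\bar t}\,\frac{\partial h_{i\bar t}}{\partial z_k}\,\frac{\partial h_{s\bar j}}{\partial \bar z_l},$$ and for $X,Y,Z,T\in T^{1,0}_pM$, $R_h(X,\overline Y,Z,\overline T)=\sum_{i,j,k,l} R_{i\bar jk\bar l}X_i\overline{Y}_jZ_k\overline{T}_l$. For nonzero $X,Y\in T^{1,0}_pM$ the holomorphic bisectional curvature is $$HBC(h)(X,Y)=\frac{R_h(X,\overline X,Y,\overline Y)}{h(X,\overline X)\,h(Y,\overline Y)}.$$ For $C\in\mathbb{R}$, $HBC(h)\le C$ means $HBC(h)(X,Y)\le C$ for all $p\in M$ and all nonzero $X,Y\in T_p^{1,0}M$. Spherical comparison. Write $\|X\|_h^2=h(X,\overline X)$ and let $S_h=\{X\in T^{1,0}M : \|X\|_h=1\}$ be the sphere bundle of $h$. For two Hermitian metrics $h,g$ on $M$, the spherical comparison of $h$ with respect to $g$ is $$C(h,g)=\inf_{X\in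 S_{h+g}}\|X\|_h^2 .$$ *)

theory Defs
  imports "HOL-Analysis.Analysis"
begin

section \<open>Complex manifolds\<close>

text \<open>Partial derivatives are taken along a direction of the underlying real vector space, which
  suffices in finite dimension.\<close>

primrec C_k_on :: "nat \<Rightarrow> 'a::real_normed_vector set \<Rightarrow> ('a \<Rightarrow> 'b::real_normed_vector) \<Rightarrow> bool" where
  "C_k_on 0 S f \<longleftrightarrow> continuous_on S f"
| "C_k_on (Suc k) S f \<longleftrightarrow> (\<forall>x\<in>S. f differentiable (at x)) \<and>
     (\<forall>v. C_k_on k S (\<lambda>x. frechet_derivative f (at x) v))"

definition smooth_on :: "'a::real_normed_vector set \<Rightarrow> ('a \<Rightarrow> 'b::real_normed_vector) \<Rightarrow> bool" where
  "smooth_on S f \<longleftrightarrow> (\<forall>k. C_k_on k S f)"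

definition holomorphic_map_on :: "(complex^'n \<Rightarrow> complex^'m) \<Rightarrow> (complex^'n) set \<Rightarrow> bool" where
  "holomorphic_map_on F S \<longleftrightarrow>
     (\<forall>z\<in>S. \<exists>J :: complex^'n^'m. (F has_derivative (\<lambda>v. J *v v)) (at z))"

text \<open>A chart is a pair of its domain and its coordinate map; the values of the coordinate map
  outside the domain are irrelevant.\<close>

type_synonym ('a, 'n) chart = "'a set \<times> ('a \<Rightarrow> complex^'n)"

definition chart_inv :: "('a, 'n::finite) chart \<Rightarrow> complex^'n \<Rightarrow> 'a" where
  "chart_inv c = inv_into (fst c) (snd c)"

definition transition :: "('a, 'n::finite) chart \<Rightarrow> ('a, 'n) chart \<Rightarrow> complex^'n \<Rightarrow> complex^'n" where
  "transition c d = snd d \<circ> chart_inv c"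

text \<open>The atlas need not be maximal.\<close>

definition complex_manifold :: "'a topology \<Rightarrow> ('a, 'n::finite) chart set \<Rightarrow> bool" where
  "complex_manifold M A \<longleftrightarrow>
     Hausdorff_space M \<and> second_countable M \<and>
     \<Union> (fst ` A) = topspace M \<and>
     (\<forall>c\<in>A. openin M (fst c) \<and> open (snd c ` fst c) \<and>
        homeomorphic_map (subtopology M (fst c)) (top_of_set (snd c ` fst c)) (snd c)) \<and>
     (\<forall>c\<in>A. \<forall>d\<in>A. holomorphic_map_on (transition c d) (snd c ` (fst c \<inter> fst d)))"

section \<open>The holomorphic tangent bundle\<close>

text \<open>An element of \<open>T\<^sup>1\<^sup>,\<^sup>0\<close> at \<open>p\<close> is represented by the family of its coordinate vectors in all
  charts around \<open>p\<close>, which are related by the holomorphic Jacobians of the transition maps; the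
  entries at all other charts are zero, so that equality of tangent vectors is equality of
  functions.\<close>

type_synonym ('a, 'n) tangent = "('a, 'n) chart \<Rightarrow> complex^'n"

definition charts_at :: "('a, 'n::finite) chart set \<Rightarrow> 'a \<Rightarrow> ('a, 'n) chart set" where
  "charts_at A p = {c \<in> A. p \<in> fst c}"

definition tangent_space :: "('a, 'n::finite) chart set \<Rightarrow> 'a \<Rightarrow> ('a, 'n) tangent set" where
  "tangent_space A p = {X.
     (\<forall>c\<in>charts_at A p. \<forall>d\<in>charts_at A p.
        X d = frechet_derivative (transition c d) (at (snd c p)) (X c)) \<and>
     (\<forall>c. c \<notin> charts_at A p \<longrightarrow> X c = 0)}"

definition zero_tangent :: "('a, 'n::finite) tangent" where
  "zero_tangent = (\<lambda>c. 0)"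

definition add_tangent :: "('a, 'n::finite) tangent \<Rightarrow> ('a, 'n) tangent \<Rightarrow> ('a, 'n) tangent" where
  "add_tangent X Y = (\<lambda>c. X c + Y c)"

definition scale_tangent :: "complex \<Rightarrow> ('a, 'n::finite) tangent \<Rightarrow> ('a, 'n) tangent" where
  "scale_tangent a X = (\<lambda>c. a *s X c)"

text \<open>The coordinate vector \<open>\<partial>/\<partial>z\<^sub>i\<close> at \<open>p\<close> of the chart \<open>c\<close>.\<close>

definition coord_vector ::
    "('a, 'n::finite) chart set \<Rightarrow> ('a, 'n) chart \<Rightarrow> 'a \<Rightarrow> 'n \<Rightarrow> ('a, 'n) tangent" where
  "coord_vector A c p i = (\<lambda>d. if d \<in> charts_at A p
     then frechet_derivative (transition c d) (at (snd c p)) (axis i 1) else 0)"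

section \<open>Hermitian metrics\<close>

text \<open>\<open>h p X Y\<close> stands for \<open>h(X, cnj Y)\<close> at \<open>p\<close>: linear in \<open>X\<close>, conjugate linear in \<open>Y\<close>. Its values
  outside the tangent spaces are irrelevant.\<close>

type_synonym ('a, 'n) hform = "'a \<Rightarrow> ('a, 'n) tangent \<Rightarrow> ('a, 'n) tangent \<Rightarrow> complex"

definition local_expr ::
    "('a, 'n::finite) chart set \<Rightarrow> ('a, 'n) hform \<Rightarrow> ('a, 'n) chart \<Rightarrow> complex^'n \<Rightarrow> complex^'n^'n" where
  "local_expr A h c z = (\<chi> i j. h (chart_inv c z)
     (coord_vector A c (chart_inv c z) i) (coord_vector A c (chart_inv c z) j))"

definition hermitian_metric ::
    "'a topology \<Rightarrow> ('a, 'n::finite) chart set \<Rightarrow> ('a, 'n) hform \<Rightarrow> bool" where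
  "hermitian_metric M A h \<longleftrightarrow>
     (\<forall>p\<in>topspace M. \<forall>X\<in>tangent_space A p. \<forall>Y\<in>tangent_space A p.
        (\<forall>Z\<in>tangent_space A p. h p (add_tangent X Y) Z = h p X Z + h p Y Z) \<and>
        (\<forall>a. h p (scale_tangent a X) Y = a * h p X Y) \<and>
        h p Y X = cnj (h p X Y)) \<and>
     (\<forall>p\<in>topspace M. \<forall>X\<in>tangent_space A p. X \<noteq> zero_tangent \<longrightarrow> 0 < Re (h p X X)) \<and>
     (\<forall>c\<in>A. \<forall>i j. smooth_on (snd c ` fst c) (\<lambda>z. local_expr A h c z $ i $ j))"

definition add_metric :: "('a, 'n::finite) hform \<Rightarrow> ('a, 'n) hform \<Rightarrow> ('a, 'n) hform" where
  "add_metric h g = (\<lambda>p X Y. h p X Y + g p X Y)"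

definition hnorm :: "('a, 'n::finite) hform \<Rightarrow> 'a \<Rightarrow> ('a, 'n) tangent \<Rightarrow> real" where
  "hnorm h p X = sqrt (Re (h p X X))"

definition sphere_bundle ::
    "'a topology \<Rightarrow> ('a, 'n::finite) chart set \<Rightarrow> ('a, 'n) hform \<Rightarrow> ('a \<times> ('a, 'n) tangent) set" where
  "sphere_bundle M A h =
     {(p, X). p \<in> topspace M \<and> X \<in> tangent_space A p \<and> hnorm h p X = 1}"

definition spherical_comparison ::
    "'a topology \<Rightarrow> ('a, 'n::finite) chart set \<Rightarrow> ('a, 'n) hform \<Rightarrow> ('a, 'n) hform \<Rightarrow> real" where
  "spherical_comparison M A h g =
     (INF (p, X) \<in> sphere_bundle M A (add_metric h g). (hnorm h p X)\<^sup>2)"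

section \<open>Curvature\<close>

text \<open>Wirtinger derivatives: \<open>\<partial>/\<partial>z\<^sub>k = (\<partial>/\<partial>x\<^sub>k - i \<partial>/\<partial>y\<^sub>k) / 2\<close> and
  \<open>\<partial>/\<partial>cnj z\<^sub>k = (\<partial>/\<partial>x\<^sub>k + i \<partial>/\<partial>y\<^sub>k) / 2\<close>.\<close>

definition dz :: "'n::finite \<Rightarrow> (complex^'n \<Rightarrow> complex) \<Rightarrow> complex^'n \<Rightarrow> complex" where
  "dz k f z = (frechet_derivative f (at z) (axis k 1)
     - \<i> * frechet_derivative f (at z) (axis k \<i>)) / 2"

definition dzbar :: "'n::finite \<Rightarrow> (complex^'n \<Rightarrow> complex) \<Rightarrow> complex^'n \<Rightarrow> complex" where
  "dzbar k f z = (frechet_derivative f (at z) (axis k 1)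
     + \<i> * frechet_derivative f (at z) (axis k \<i>)) / 2"

text \<open>The coefficient of the inverse metric with upper indices \<open>s\<close> and (barred) \<open>t\<close> is defined by
  \<open>(\<Sum>t. H\<^sub>i\<^sub>t * inverse_metric H s t) = (if i = s then 1 else 0)\<close>, i.e. it is the \<open>(t, s)\<close> entry of
  the inverse of the matrix \<open>H\<close>. This is the convention under which the curvature is a tensor.\<close>

definition inverse_metric :: "complex^'n^'n \<Rightarrow> 'n::finite \<Rightarrow> 'n \<Rightarrow> complex" where
  "inverse_metric H s t = matrix_inv H $ t $ s"

definition curv_coeff :: "('a, 'n::finite) chart set \<Rightarrow> ('a, 'n) hform \<Rightarrow> ('a, 'n) chart \<Rightarrow> 'a \<Rightarrow>
    'n \<Rightarrow> 'n \<Rightarrow> 'n \<Rightarrow> 'n \<Rightarrow> complex" where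
  "curv_coeff A h c p i j k l =
     (let H = local_expr A h c; z = snd c p in
      - dz k (dzbar l (\<lambda>w. H w $ i $ j)) z
      + (\<Sum>s\<in>UNIV. \<Sum>t\<in>UNIV. inverse_metric (H z) s t *
           dz k (\<lambda>w. H w $ i $ t) z * dzbar l (\<lambda>w. H w $ s $ j) z))"

text \<open>\<open>curvature A h c p X Y Z T\<close> is \<open>R\<^sub>h(X, cnj Y, Z, cnj T)\<close> at \<open>p\<close>, computed in the chart \<open>c\<close>
  around \<open>p\<close>.\<close>

definition curvature :: "('a, 'n::finite) chart set \<Rightarrow> ('a, 'n) hform \<Rightarrow> ('a, 'n) chart \<Rightarrow> 'a \<Rightarrow>
    ('a, 'n) tangent \<Rightarrow> ('a, 'n) tangent \<Rightarrow> ('a, 'n) tangent \<Rightarrow> ('a, 'n) tangent \<Rightarrow> complex" where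
  "curvature A h c p X Y Z T =
     (\<Sum>i\<in>UNIV. \<Sum>j\<in>UNIV. \<Sum>k\<in>UNIV. \<Sum>l\<in>UNIV.
        curv_coeff A h c p i j k l * X c $ i * cnj (Y c $ j) * Z c $ k * cnj (T c $ l))"

text \<open>For a Hermitian metric all three numbers below are real; \<open>Re\<close> only changes their type.\<close>

definition HBC :: "('a, 'n::finite) chart set \<Rightarrow> ('a, 'n) hform \<Rightarrow> ('a, 'n) chart \<Rightarrow> 'a \<Rightarrow>
    ('a, 'n) tangent \<Rightarrow> ('a, 'n) tangent \<Rightarrow> real" where
  "HBC A h c p X Y = Re (curvature A h c p X X Y Y) / (Re (h p X X) * Re (h p Y Y))"

text \<open>The curvature does not depend on the chart around \<open>p\<close>, so the quantification over all charts
  around \<open>p\<close> is harmless.\<close>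

definition HBC_le ::
    "'a topology \<Rightarrow> ('a, 'n::finite) chart set \<Rightarrow> ('a, 'n) hform \<Rightarrow> real \<Rightarrow> bool" where
  "HBC_le M A h C \<longleftrightarrow>
     (\<forall>p\<in>topspace M. \<forall>c\<in>charts_at A p. \<forall>X\<in>tangent_space A p. \<forall>Y\<in>tangent_space A p.
        X \<noteq> zero_tangent \<longrightarrow> Y \<noteq> zero_tangent \<longrightarrow> HBC A h c p X Y \<le> C)"

end

theory Submission
  imports Defs
begin

text \<open>
  The sum of two Hermitian metrics is at most as curved as the metrics together:
  \<open>R\<^bsub>h+g\<^esub>(X, cnj X, Y, cnj Y) \<le> R\<^sub>h(X, cnj X, Y, cnj Y) + R\<^sub>g(X, cnj X, Y, cnj Y)\<close> for all \<open>X\<close>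
  and \<open>Y\<close> (\<open>curvature_add_metric_le\<close>). In a chart, the second order part of the curvature is
  additive in the metric. The first order part is the squared norm, with respect to the inverse metric, of
  the covector \<open>a\<^sub>t = \<Sum>\<^sub>i\<^sub>,\<^sub>k X\<^sub>i Y\<^sub>k \<partial>h\<^sub>i\<^sub>t/\<partial>z\<^sub>k\<close>, which is also additive in the metric
  (\<open>curvature_decomposition\<close>). The inequality is therefore linear algebra: if \<open>H\<close> and \<open>G\<close> are
  positive definite Hermitian matrices and \<open>a\<close>, \<open>b\<close> covectors, then the squared norm of \<open>a + b\<close>
  with respect to \<open>H + G\<close> is at most the sum of the squared norms of \<open>a\<close> with respect to \<open>H\<close> and
  of \<open>b\<close> with respect to \<open>G\<close> (\<open>dual_quad_add_le\<close>).

  The curvature bounds on \<open>g\<close> and \<open>h\<close> now give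
  \<open>R\<^bsub>h+g\<^esub>(X, cnj X, Y, cnj Y) \<le> - B1 g(X, cnj X) g(Y, cnj Y) - B2 h(X, cnj X) h(Y, cnj Y)\<close>.
  By homogeneity the spherical comparison satisfies \<open>h(X, cnj X) \<ge> C(h, g) (h + g)(X, cnj X)\<close>,
  and likewise with \<open>g\<close> and \<open>h\<close> exchanged (\<open>spherical_comparison_bounds\<close>). Both comparison
  constants are nonnegative, so these inequalities may be multiplied for \<open>X\<close> and \<open>Y\<close>; division by
  \<open>(h + g)(X, cnj X) (h + g)(Y, cnj Y)\<close> yields the theorem.

  The definitions of a metric and of the tangent space are free of coordinates, while the curvature
  is computed in a chart. The passage between the two rests on the chain rule for transition maps,
  by which a coordinate vector in one chart extends to a unique tangent vector.
\<close>

section \<open>The quadratic form of an inverse Hermitian matrix\<close>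

definition sesq :: "complex^'n^'n \<Rightarrow> complex^'n \<Rightarrow> complex^'n \<Rightarrow> complex" where
  "sesq H u v = (\<Sum>i\<in>UNIV. \<Sum>j\<in>UNIV. H $ i $ j * u $ i * cnj (v $ j))"

definition hermitian_matrix :: "complex^'n^'n \<Rightarrow> bool" where
  "hermitian_matrix H \<longleftrightarrow> (\<forall>i j. H $ j $ i = cnj (H $ i $ j))"

definition positive_hermitian :: "complex^'n^'n \<Rightarrow> bool" where
  "positive_hermitian H \<longleftrightarrow> hermitian_matrix H \<and> (\<forall>u. u \<noteq> 0 \<longrightarrow> 0 < Re (sesq H u u))"

text \<open>The squared norm of the covector \<open>a\<close> with respect to the metric inverse to \<open>H\<close>.\<close>

definition dual_quad :: "complex^'n^'n \<Rightarrow> complex^'n \<Rightarrow> complex" where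
  "dual_quad H a = (\<Sum>s\<in>UNIV. \<Sum>t\<in>UNIV. inverse_metric H s t * a $ t * cnj (a $ s))"

lemma sesq_add_matrix: "sesq (H + G) u v = sesq H u v + sesq G u v"
  by (simp add: sesq_def distrib_right sum.distrib)

lemma sesq_diff_left: "sesq H (u - v) w = sesq H u w - sesq H v w"
  by (simp add: sesq_def algebra_simps sum_subtractf)

lemma sesq_diff_right: "sesq H u (v - w) = sesq H u v - sesq H u w"
  by (simp add: sesq_def algebra_simps sum_subtractf)

lemma sesq_vector_matrix: "sesq H u v = (\<Sum>j\<in>UNIV. (u v* H) $ j * cnj (v $ j))"
  unfolding sesq_def
  by (subst sum.swap) (simp add: vector_matrix_mult_def sum_distrib_right sum_distrib_left mult_ac)

lemma sesq_commute: "hermitian_matrix H \<Longrightarrow> sesq H v u = cnj (sesq H u v)"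
proof -
  assume H: "hermitian_matrix H"
  have "H $ j $ i * v $ j * cnj (u $ i) = cnj (H $ i $ j * u $ i * cnj (v $ j))" for i j
  proof -
    have "H $ j $ i = cnj (H $ i $ j)"
      using H unfolding hermitian_matrix_def by blast
    then show ?thesis
      by simp
  qed
  then show ?thesis
    unfolding sesq_def cnj_sum by (subst (2) sum.swap) (simp only:)
qed

lemma positive_hermitian_add:
  assumes "positive_hermitian H" "positive_hermitian G"
  shows "positive_hermitian (H + G)"
proof -
  have "(H + G) $ j $ i = cnj ((H + G) $ i $ j)" for i j
  proof -
    have "H $ j $ i = cnj (H $ i $ j)" "G $ j $ i = cnj (G $ i $ j)"
      using assms unfolding positive_hermitian_def hermitian_matrix_def by blast+
    then show ?thesis
      by simp
  qed
  then have "hermitian_matrix (H + G)"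
    unfolding hermitian_matrix_def by blast
  moreover have "0 < Re (sesq (H + G) u u)" if "u \<noteq> 0" for u
    unfolding sesq_add_matrix plus_complex.sel
    using assms that unfolding positive_hermitian_def by (intro add_pos_pos) blast+
  ultimately show ?thesis
    unfolding positive_hermitian_def by blast
qed

lemma positive_hermitian_nonneg: "positive_hermitian H \<Longrightarrow> 0 \<le> Re (sesq H u u)"
  by (cases "u = 0") (auto simp: positive_hermitian_def sesq_def intro: less_imp_le)

text \<open>A vector \<open>x\<close> with \<open>x v* H = 0\<close> has \<open>H(x, x) = 0\<close>, so \<open>x = 0\<close>. This is a statement on the
  kernel of the transpose, since the first argument of the form belongs to the row index.\<close>

lemma positive_hermitian_invertible:
  fixes H :: "complex^'n^'n"
  assumes "positive_hermitian H"
  shows "invertible H"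
proof -
  have "x = 0" if "transpose H *v x = 0" for x
  proof -
    have "x v* H = 0"
      using that by simp
    then have "sesq H x x = 0"
      by (simp add: sesq_vector_matrix)
    with assms show "x = 0"
      unfolding positive_hermitian_def by force
  qed
  then obtain B where "B ** transpose H = mat 1"
    using matrix_left_invertible_ker by blast
  then have "H ** transpose B = mat 1"
    by (metis matrix_transpose_mul transpose_mat transpose_transpose)
  then show ?thesis
    using invertible_right_inverse by blast
qed

lemma vector_matrix_surj:
  fixes H :: "complex^'n^'n"
  assumes "positive_hermitian H"
  obtains u where "a = u v* H" "u = a v* matrix_inv H"
proof -
  have "\<exists>B. H ** B = mat 1 \<and> B ** H = mat 1"
    using positive_hermitian_invertible[OF assms] by (auto simp: invertible_def)
  then have "matrix_inv H ** H = mat 1"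
    unfolding matrix_inv_def by (metis (mono_tags, lifting) someI_ex)
  then have "a = (a v* matrix_inv H) v* H"
    by (simp add: vector_matrix_mul_assoc)
  then show ?thesis
    using that by blast
qed

text \<open>The metric identifies vectors with covectors, and the inverse metric is the one transported
  along this identification. This description no longer mentions the inverse matrix.\<close>

lemma dual_quad_eq:
  fixes H :: "complex^'n^'n"
  assumes "positive_hermitian H"
  obtains u where "a = u v* H" "dual_quad H a = sesq H u u"
proof -
  obtain u where u: "a = u v* H" "u = a v* matrix_inv H"
    using vector_matrix_surj[OF assms] by blast
  have "dual_quad H a = (\<Sum>s\<in>UNIV. u $ s * cnj (a $ s))"
    by (subst u(2)) (simp add: dual_quad_def inverse_metric_def vector_matrix_mult_def
        sum_distrib_right sum_distrib_left mult_ac)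
  also have "\<dots> = cnj (sesq H u u)"
    by (simp add: sesq_vector_matrix flip: u(1)) (simp add: mult_ac)
  also have "\<dots> = sesq H u u"
    using assms sesq_commute unfolding positive_hermitian_def by metis
  finally show ?thesis
    using u(1) that by blast
qed

text \<open>Let \<open>u\<close>, \<open>v\<close>, \<open>w\<close> be the vectors dual to \<open>a\<close>, \<open>b\<close>, \<open>a + b\<close> with respect to \<open>H\<close>, \<open>G\<close>,
  \<open>H + G\<close>, and let a covector \<open>a\<close> take the value \<open>a(w) = \<Sum>\<^sub>t a\<^sub>t cnj w\<^sub>t\<close> at \<open>w\<close>. Then
  \<open>H(u, w) + G(v, w) = (a + b)(w) = (H + G)(w, w)\<close>, so the difference of the two
  sides is \<open>H(u - w, u - w) + G(v - w, v - w)\<close>, which is nonnegative.\<close>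

lemma dual_quad_add_le:
  fixes H G :: "complex^'n^'n"
  assumes H: "positive_hermitian H" and G: "positive_hermitian G"
  shows "Re (dual_quad (H + G) (a + b)) \<le> Re (dual_quad H a) + Re (dual_quad G b)"
proof -
  obtain u where u: "a = u v* H" "dual_quad H a = sesq H u u"
    using dual_quad_eq[OF H] by blast
  obtain v where v: "b = v v* G" "dual_quad G b = sesq G v v"
    using dual_quad_eq[OF G] by blast
  obtain w where w: "a + b = w v* (H + G)" "dual_quad (H + G) (a + b) = sesq (H + G) w w"
    using dual_quad_eq[OF positive_hermitian_add[OF H G]] by blast
  have cross: "sesq H u w + sesq G v w = sesq (H + G) w w"
    unfolding sesq_vector_matrix w(1)[symmetric] u(1)[symmetric] v(1)[symmetric]
    by (simp add: distrib_right sum.distrib)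
  have "Re (sesq H w u) = Re (sesq H u w)" "Re (sesq G w v) = Re (sesq G v w)"
    using H G sesq_commute[of H w u] sesq_commute[of G w v]
    by (simp_all add: positive_hermitian_def)
  moreover have "0 \<le> Re (sesq H (u - w) (u - w)) + Re (sesq G (v - w) (v - w))"
    using positive_hermitian_nonneg[OF H] positive_hermitian_nonneg[OF G] by (simp add: add_nonneg_nonneg)
  moreover have "Re (sesq H u w) + Re (sesq G v w) = Re (sesq H w w) + Re (sesq G w w)"
    using arg_cong[OF cross, of Re] by (simp add: sesq_add_matrix)
  ultimately show ?thesis
    unfolding u(2) v(2) w(2) by (simp add: sesq_diff_left sesq_diff_right sesq_add_matrix)
qed

lemma sesquilinear_expansion:
  fixes F :: "complex^'n \<Rightarrow> complex^'n \<Rightarrow> complex"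
  assumes add: "\<And>u v w. F (u + v) w = F u w + F v w"
    and scale: "\<And>a u v. F (a *s u) v = a * F u v"
    and herm: "\<And>u v. F v u = cnj (F u v)"
  shows "F u v = sesq (\<chi> i j. F (axis i 1) (axis j 1)) u v"
proof -
  have zero: "F 0 w = 0" for w
    using add[of 0 0 w] by simp
  have left: "F u w = (\<Sum>i\<in>UNIV. u $ i * F (axis i 1) w)" for u w
  proof -
    have "F (\<Sum>i\<in>S. u $ i *s axis i 1) w = (\<Sum>i\<in>S. u $ i * F (axis i 1) w)" if "finite S" for S
      using that by (induction S) (simp_all add: add scale zero)
    from this[of UNIV] show ?thesis
      by (simp add: basis_expansion)
  qed
  have "F w v = (\<Sum>j\<in>UNIV. cnj (v $ j) * F w (axis j 1))" for w
  proof -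
    have "F w v = cnj (\<Sum>j\<in>UNIV. v $ j * F (axis j 1) w)"
      by (subst herm) (simp only: left[of v w])
    also have "\<dots> = (\<Sum>j\<in>UNIV. cnj (v $ j) * cnj (F (axis j 1) w))"
      by simp
    also have "\<dots> = (\<Sum>j\<in>UNIV. cnj (v $ j) * F w (axis j 1))"
      by (simp only: herm[of w, symmetric])
    finally show ?thesis .
  qed
  with left[of u v] show ?thesis
    by (simp add: sesq_def sum_distrib_left mult_ac)
qed

section \<open>Wirtinger derivatives\<close>

lemma frechet_cnj:
  fixes f :: "complex^'n \<Rightarrow> complex"
  assumes "f differentiable at z"
  shows "frechet_derivative (\<lambda>w. cnj (f w)) (at z) v = cnj (frechet_derivative f (at z) v)"
proof -
  have "(f has_derivative frechet_derivative f (at z)) (at z)"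
    using assms frechet_derivative_works by blast
  then have "((\<lambda>w. cnj (f w)) has_derivative (\<lambda>v. cnj (frechet_derivative f (at z) v))) (at z)"
    by (rule has_derivative_cnj)
  then show ?thesis
    using frechet_derivative_at by metis
qed

lemma frechet_add:
  assumes "f differentiable at z" "g differentiable at z"
  shows "frechet_derivative (\<lambda>w. f w + g w) (at z) v
    = frechet_derivative f (at z) v + frechet_derivative g (at z) v"
proof -
  have "((\<lambda>w. f w + g w) has_derivative
      (\<lambda>v. frechet_derivative f (at z) v + frechet_derivative g (at z) v)) (at z)"
    using assms frechet_derivative_works by (blast intro: has_derivative_add)
  then show ?thesis
    using frechet_derivative_at by metis
qed

lemma dzbar_cnj: "f differentiable at z \<Longrightarrow> dzbar k (\<lambda>w. cnj (f w)) z = cnj (dz k f z)"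
  by (simp add: dz_def dzbar_def frechet_cnj)

lemma dz_add:
  assumes "f differentiable at z" "g differentiable at z"
  shows "dz k (\<lambda>w. f w + g w) z = dz k f z + dz k g z"
  by (simp add: dz_def frechet_add[OF assms] algebra_simps add_divide_distrib diff_divide_distrib)

lemma dzbar_add:
  assumes "f differentiable at z" "g differentiable at z"
  shows "dzbar k (\<lambda>w. f w + g w) z = dzbar k f z + dzbar k g z"
  by (simp add: dzbar_def frechet_add[OF assms] algebra_simps add_divide_distrib)

lemma smooth_on_differentiable:
  assumes "smooth_on S f" "z \<in> S"
  shows "f differentiable at z"
proof -
  have "C_k_on (Suc 0) S f"
    using assms(1) unfolding smooth_on_def by blast
  with assms(2) show ?thesis
    by simp
qed

lemma smooth_on_dzbar_differentiable:
  fixes f :: "complex^'n \<Rightarrow> complex"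
  assumes "smooth_on S f" "z \<in> S"
  shows "dzbar k f differentiable at z"
proof -
  have "C_k_on (Suc (Suc 0)) S f"
    using assms(1) unfolding smooth_on_def by blast
  then have "(\<lambda>x. frechet_derivative f (at x) v) differentiable at z" for v
    using assms(2) by simp
  then show ?thesis
    unfolding dzbar_def [abs_def] divide_inverse
    by (intro differentiable_mult differentiable_add differentiable_const)
qed

text \<open>The outer derivative needs the additivity of the inner one on a neighbourhood of the point,
  whence the open set.\<close>

lemma dz_dzbar_add:
  fixes f g :: "complex^'n \<Rightarrow> complex"
  assumes f: "smooth_on S f" and g: "smooth_on S g" and S: "open S" "z \<in> S"
  shows "dz k (dzbar l (\<lambda>w. f w + g w)) z = dz k (dzbar l f) z + dz k (dzbar l g) z"
proof -
  have diff: "(\<lambda>w. dzbar l f w + dzbar l g w) differentiable at z"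
    using smooth_on_dzbar_differentiable[OF f S(2)] smooth_on_dzbar_differentiable[OF g S(2)]
    by (rule differentiable_add)
  have "frechet_derivative (\<lambda>w. dzbar l f w + dzbar l g w) (at z)
      = frechet_derivative (dzbar l (\<lambda>w. f w + g w)) (at z)"
    by (rule frechet_derivative_transform_within_open[OF diff S])
      (simp add: dzbar_add smooth_on_differentiable[OF f] smooth_on_differentiable[OF g])
  then have "dz k (dzbar l (\<lambda>w. f w + g w)) z = dz k (\<lambda>w. dzbar l f w + dzbar l g w) z"
    by (simp add: dz_def)
  then show ?thesis
    by (simp add: dz_add smooth_on_dzbar_differentiable[OF f S(2)]
        smooth_on_dzbar_differentiable[OF g S(2)])
qed

section \<open>Tangent vectors in a chart\<close>

text \<open>The coordinate vector \<open>u\<close> in the chart \<open>c\<close> is pushed to all other charts around \<open>p\<close>; the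
  value at the remaining charts is zero, as membership in the tangent space demands.\<close>

definition tangent_of_coords ::
    "('a, 'n::finite) chart set \<Rightarrow> ('a, 'n) chart \<Rightarrow> 'a \<Rightarrow> complex^'n \<Rightarrow> ('a, 'n) tangent" where
  "tangent_of_coords A c p u = (\<lambda>d. if d \<in> charts_at A p
     then frechet_derivative (transition c d) (at (snd c p)) u else 0)"

lemma coord_vector_eq: "coord_vector A c p i = tangent_of_coords A c p (axis i 1)"
  by (simp add: coord_vector_def tangent_of_coords_def)

lemma hermitian_metricD:
  assumes "hermitian_metric M A h" "p \<in> topspace M" "X \<in> tangent_space A p" "Y \<in> tangent_space A p"
  shows hermitian_metric_add: "Z \<in> tangent_space A p \<Longrightarrow> h p (add_tangent X Y) Z = h p X Z + h p Y Z"
    and hermitian_metric_scale: "h p (scale_tangent a X) Y = a * h p X Y"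
    and hermitian_metric_commute: "h p Y X = cnj (h p X Y)"
    and hermitian_metric_pos: "X \<noteq> zero_tangent \<Longrightarrow> 0 < Re (h p X X)"
  using assms unfolding hermitian_metric_def by blast+

context
  fixes M :: "'a topology" and A :: "('a, 'n::finite) chart set"
  assumes M: "complex_manifold M A"
begin

lemma chart_inj:
  assumes "c \<in> A"
  shows "inj_on (snd c) (fst c)"
proof -
  have "openin M (fst c)"
    and "homeomorphic_map (subtopology M (fst c)) (top_of_set (snd c ` fst c)) (snd c)"
    using M assms unfolding complex_manifold_def by blast+
  then show ?thesis
    using homeomorphic_imp_injective_map openin_subset
    by (metis topspace_subtopology_subset)
qed

lemma chart_inv_left: "c \<in> A \<Longrightarrow> p \<in> fst c \<Longrightarrow> chart_inv c (snd c p) = p"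
  by (simp add: chart_inv_def chart_inj)

text \<open>Identities between transition maps hold only on overlaps of chart domains. Their images are
  open in coordinate space, so such identities can be differentiated.\<close>

lemma open_chart_image:
  assumes "c \<in> A" "openin M W" "W \<subseteq> fst c"
  shows "open (snd c ` W)"
proof -
  have op: "open (snd c ` fst c)" 
    and hom: "homeomorphic_map (subtopology M (fst c)) (top_of_set (snd c ` fst c)) (snd c)"
    using M assms(1) unfolding complex_manifold_def by blast+
  have "openin (subtopology M (fst c)) W"
    using assms by (simp add: openin_subset_topspace_eq openin_subtopology) blast
  then have "openin (top_of_set (snd c ` fst c)) (snd c ` W)"
    using homeomorphic_imp_open_map[OF hom] by (simp add: open_map_def)
  then show ?thesis
    using op openin_open_trans by blast
qed

lemma chart_open: "c \<in> A \<Longrightarrow> openin M (fst c)"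
  using M unfolding complex_manifold_def by blast

lemma transition_has_derivative:
  assumes "c \<in> charts_at A p" "d \<in> charts_at A p"
  obtains J where "(transition c d has_derivative (\<lambda>v. J *v v)) (at (snd c p))"
    and "frechet_derivative (transition c d) (at (snd c p)) = (\<lambda>v. J *v v)"
proof -
  have "holomorphic_map_on (transition c d) (snd c ` (fst c \<inter> fst d))"
    using M assms unfolding complex_manifold_def charts_at_def by blast
  moreover have "snd c p \<in> snd c ` (fst c \<inter> fst d)"
    using assms by (auto simp: charts_at_def)
  ultimately obtain J where J: "(transition c d has_derivative (\<lambda>v. J *v v)) (at (snd c p))"
    unfolding holomorphic_map_on_def by blast
  with that show ?thesis
    using frechet_derivative_at by metis
qed

text \<open>The chain rule for the composition of two transition maps. It makes the coordinate vectors
  pushed out of one chart compatible with each other.\<close>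

lemma transition_derivative_cocycle:
  assumes c: "c \<in> charts_at A p" and d: "d \<in> charts_at A p" and e: "e \<in> charts_at A p"
  shows "frechet_derivative (transition c e) (at (snd c p)) u
    = frechet_derivative (transition d e) (at (snd d p))
        (frechet_derivative (transition c d) (at (snd c p)) u)"
proof -
  obtain J where J: "(transition c d has_derivative (\<lambda>v. J *v v)) (at (snd c p))"
    "frechet_derivative (transition c d) (at (snd c p)) = (\<lambda>v. J *v v)"
    using transition_has_derivative[OF c d] by blast
  obtain K where K: "(transition d e has_derivative (\<lambda>v. K *v v)) (at (snd d p))"
    "frechet_derivative (transition d e) (at (snd d p)) = (\<lambda>v. K *v v)"
    using transition_has_derivative[OF d e] by blast
  have in_A: "c \<in> A" "d \<in> A" "e \<in> A" and p: "p \<in> fst c" "p \<in> fst d" "p \<in> fst e"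
    using c d e by (auto simp: charts_at_def)
  define W where "W = fst c \<inter> fst d \<inter> fst e"
  have W: "open (snd c ` W)"
    by (rule open_chart_image) (use in_A in \<open>auto simp: W_def intro!: openin_Int chart_open\<close>)
  have z: "snd c p \<in> snd c ` W"
    using p by (auto simp: W_def)
  have eq: "(transition d e \<circ> transition c d) w = transition c e w" if "w \<in> snd c ` W" for w
    using that in_A by (auto simp: W_def transition_def chart_inv_left)
  have "transition c d (snd c p) = snd d p"
    using in_A p by (simp add: transition_def chart_inv_left)
  then have "((transition d e \<circ> transition c d) has_derivative (\<lambda>v. K *v v) \<circ> (\<lambda>v. J *v v))
      (at (snd c p))"
    using J(1) K(1) by (intro diff_chain_at) simp_all
  then have "(transition c e has_derivative (\<lambda>v. K *v v) \<circ> (\<lambda>v. J *v v)) (at (snd c p))"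
    using has_derivative_transform_within_open[OF _ W z] eq by blast
  then have "frechet_derivative (transition c e) (at (snd c p)) = (\<lambda>v. K *v v) \<circ> (\<lambda>v. J *v v)"
    using frechet_derivative_at by metis
  then show ?thesis
    by (simp add: J(2) K(2))
qed

lemma transition_self_derivative:
  assumes c: "c \<in> charts_at A p"
  shows "frechet_derivative (transition c c) (at (snd c p)) u = u"
proof -
  have in_A: "c \<in> A" and p: "p \<in> fst c"
    using c by (auto simp: charts_at_def)
  have "open (snd c ` fst c)" "snd c p \<in> snd c ` fst c"
    using open_chart_image[OF in_A chart_open[OF in_A]] p by auto
  moreover have "((\<lambda>w. w) has_derivative (\<lambda>v. v)) (at (snd c p))"
    by (rule has_derivative_ident)
  moreover have "w = transition c c w" if "w \<in> snd c ` fst c" for w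
    using that in_A by (auto simp: transition_def chart_inv_left)
  ultimately have "(transition c c has_derivative (\<lambda>v. v)) (at (snd c p))"
    using has_derivative_transform_within_open by blast
  then show ?thesis
    using frechet_derivative_at by metis
qed

lemma tangent_of_coords_in_tangent_space:
  assumes "c \<in> charts_at A p"
  shows "tangent_of_coords A c p u \<in> tangent_space A p"
proof -
  let ?X = "tangent_of_coords A c p u"
  have "?X e = frechet_derivative (transition d e) (at (snd d p)) (?X d)"
    if "d \<in> charts_at A p" "e \<in> charts_at A p" for d e
    unfolding tangent_of_coords_def if_P[OF that(1)] if_P[OF that(2)]
    by (rule transition_derivative_cocycle[OF assms that])
  moreover have "?X d = 0" if "d \<notin> charts_at A p" for d
    using that by (simp add: tangent_of_coords_def)
  ultimately show ?thesis
    unfolding tangent_space_def by blast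
qed

text \<open>Together with the next lemma this makes \<open>tangent_of_coords\<close> a bijection from coordinate
  vectors onto the tangent space, inverse to evaluation at \<open>c\<close>.\<close>

lemma tangent_of_coords_at_chart:
  assumes "c \<in> charts_at A p"
  shows "tangent_of_coords A c p u c = u"
  using assms by (simp add: tangent_of_coords_def transition_self_derivative)

lemma tangent_of_coords_of_tangent:
  assumes "c \<in> charts_at A p" "X \<in> tangent_space A p"
  shows "tangent_of_coords A c p (X c) = X"
proof
  fix d
  show "tangent_of_coords A c p (X c) d = X d"
  proof (cases "d \<in> charts_at A p")
    case True
    then have "X d = frechet_derivative (transition c d) (at (snd c p)) (X c)"
      using assms unfolding tangent_space_def by blast
    with True show ?thesis
      by (simp add: tangent_of_coords_def)
  next
    case False
    then have "X d = 0"
      using assms(2) unfolding tangent_space_def by blast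
    with False show ?thesis
      by (simp add: tangent_of_coords_def)
  qed
qed

lemma tangent_of_coords_add:
  assumes "c \<in> charts_at A p"
  shows "tangent_of_coords A c p (u + v)
    = add_tangent (tangent_of_coords A c p u) (tangent_of_coords A c p v)"
proof
  fix d
  show "tangent_of_coords A c p (u + v) d
    = add_tangent (tangent_of_coords A c p u) (tangent_of_coords A c p v) d"
  proof (cases "d \<in> charts_at A p")
    case True
    obtain J where J: "frechet_derivative (transition c d) (at (snd c p)) = (\<lambda>v. J *v v)"
      using transition_has_derivative[OF assms True] by blast
    with True show ?thesis
      by (simp add: add_tangent_def tangent_of_coords_def matrix_vector_right_distrib)
  qed (simp add: tangent_of_coords_def add_tangent_def)
qed

lemma tangent_of_coords_scale:
  assumes "c \<in> charts_at A p"
  shows "tangent_of_coords A c p (a *s u) = scale_tangent a (tangent_of_coords A c p u)"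
proof
  fix d
  show "tangent_of_coords A c p (a *s u) d = scale_tangent a (tangent_of_coords A c p u) d"
  proof (cases "d \<in> charts_at A p")
    case True
    obtain J where J: "frechet_derivative (transition c d) (at (snd c p)) = (\<lambda>v. J *v v)"
      using transition_has_derivative[OF assms True] by blast
    with True show ?thesis
      by (simp add: scale_tangent_def tangent_of_coords_def vector_scalar_commute)
  qed (simp add: tangent_of_coords_def scale_tangent_def)
qed

lemma scale_tangent_in_tangent_space:
  assumes "c \<in> charts_at A p" "X \<in> tangent_space A p"
  shows "scale_tangent a X \<in> tangent_space A p"
  using tangent_of_coords_in_tangent_space[OF assms(1), of "a *s X c"] assms
  by (simp add: tangent_of_coords_scale tangent_of_coords_of_tangent)

section \<open>A Hermitian metric in a chart\<close>

lemma metric_eq_sesq: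
  assumes h: "hermitian_metric M A h" and p: "p \<in> topspace M" and c: "c \<in> charts_at A p"
  shows "h p (tangent_of_coords A c p u) (tangent_of_coords A c p v)
    = sesq (local_expr A h c (snd c p)) u v"
proof -
  let ?T = "tangent_of_coords A c p"
  let ?F = "\<lambda>u v. h p (?T u) (?T v)"
  note T = tangent_of_coords_in_tangent_space[OF c]
  have "?F u v = sesq (\<chi> i j. ?F (axis i 1) (axis j 1)) u v"
  proof (rule sesquilinear_expansion)
    show "?F (u + v) w = ?F u w + ?F v w" for u v w
      unfolding tangent_of_coords_add[OF c] by (rule hermitian_metric_add[OF h p T T T])
    show "?F (a *s u) v = a * ?F u v" for a u v
      unfolding tangent_of_coords_scale[OF c] by (rule hermitian_metric_scale[OF h p T T])
    show "?F v u = cnj (?F u v)" for u v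
      by (rule hermitian_metric_commute[OF h p T T])
  qed
  moreover have "(\<chi> i j. ?F (axis i 1) (axis j 1)) = local_expr A h c (snd c p)"
    using c by (simp add: local_expr_def charts_at_def chart_inv_left coord_vector_eq)
  ultimately show ?thesis
    by simp
qed

lemma positive_hermitian_local_expr:
  assumes h: "hermitian_metric M A h" and p: "p \<in> topspace M" and c: "c \<in> charts_at A p"
  shows "positive_hermitian (local_expr A h c (snd c p))"
proof -
  let ?T = "tangent_of_coords A c p"
  note T = tangent_of_coords_in_tangent_space[OF c]
  have "hermitian_matrix (local_expr A h c (snd c p))"
  proof -
    have "chart_inv c (snd c p) = p"
      using c by (simp add: charts_at_def chart_inv_left)
    then show ?thesis
      unfolding hermitian_matrix_def local_expr_def vec_lambda_beta coord_vector_eq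
      by (auto simp only: intro: hermitian_metric_commute[OF h p T T])
  qed
  moreover have "0 < Re (sesq (local_expr A h c (snd c p)) u u)" if "u \<noteq> 0" for u
  proof -
    have "?T u \<noteq> zero_tangent"
      using that tangent_of_coords_at_chart[OF c, of u] by (auto simp: zero_tangent_def)
    then have "0 < Re (h p (?T u) (?T u))"
      by (rule hermitian_metric_pos[OF h p T T])
    then show ?thesis
      by (simp add: metric_eq_sesq[OF assms])
  qed
  ultimately show ?thesis
    by (simp add: positive_hermitian_def)
qed

lemma local_expr_smooth:
  assumes "hermitian_metric M A h" "c \<in> A"
  shows "smooth_on (snd c ` fst c) (\<lambda>z. local_expr A h c z $ i $ j)"
  using assms by (simp add: hermitian_metric_def)

text \<open>Complex conjugation exchanges the two Wirtinger derivatives, and the local expression is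
  Hermitian at all points of the chart, not only at \<open>p\<close>.\<close>

lemma dzbar_local_expr:
  assumes h: "hermitian_metric M A h" and p: "p \<in> topspace M" and c: "c \<in> charts_at A p"
  shows "dzbar l (\<lambda>w. local_expr A h c w $ s $ j) (snd c p)
    = cnj (dz l (\<lambda>w. local_expr A h c w $ j $ s) (snd c p))"
proof -
  let ?H = "local_expr A h c"
  have in_A: "c \<in> A" and pc: "p \<in> fst c"
    using c by (auto simp: charts_at_def)
  have z: "open (snd c ` fst c)" "snd c p \<in> snd c ` fst c"
    using open_chart_image[OF in_A chart_open[OF in_A]] pc by auto
  have sym: "?H w $ s $ j = cnj (?H w $ j $ s)" if w: "w \<in> snd c ` fst c" for w
  proof -
    obtain q where q: "q \<in> fst c" "w = snd c q"
      using w by blast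
    then have "q \<in> topspace M" "c \<in> charts_at A q"
      using openin_subset[OF chart_open[OF in_A]] in_A by (auto simp: charts_at_def)
    then have "hermitian_matrix (?H w)"
      using positive_hermitian_local_expr[OF h] q(2) unfolding positive_hermitian_def by blast
    then show ?thesis
      unfolding hermitian_matrix_def by blast
  qed
  note diff = smooth_on_differentiable[OF local_expr_smooth[OF h in_A] z(2)]
  have "frechet_derivative (\<lambda>w. ?H w $ s $ j) (at (snd c p))
      = frechet_derivative (\<lambda>w. cnj (?H w $ j $ s)) (at (snd c p))"
    by (rule frechet_derivative_transform_within_open[OF diff z sym])
  then have "dzbar l (\<lambda>w. ?H w $ s $ j) (snd c p) = dzbar l (\<lambda>w. cnj (?H w $ j $ s)) (snd c p)"
    by (simp add: dzbar_def)
  then show ?thesis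
    by (simp add: dzbar_cnj[OF diff])
qed

end

section \<open>The curvature of a sum of metrics\<close>

text \<open>The derivative of the covector \<open>h(x, \<cdot>)\<close> in the holomorphic direction \<open>y\<close>, with \<open>x\<close> held
  constant in coordinates.\<close>

definition metric_derivative ::
    "('a, 'n::finite) chart set \<Rightarrow> ('a, 'n) hform \<Rightarrow> ('a, 'n) chart \<Rightarrow>
      complex^'n \<Rightarrow> complex^'n \<Rightarrow> complex^'n \<Rightarrow> complex^'n" where
  "metric_derivative A h c z x y =
     (\<chi> t. \<Sum>i\<in>UNIV. \<Sum>k\<in>UNIV. x $ i * y $ k * dz k (\<lambda>w. local_expr A h c w $ i $ t) z)"

text \<open>The Levi form in the direction \<open>y\<close> of the function \<open>h(x, cnj x)\<close> with constant
  coordinates \<open>x\<close>.\<close>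

definition levi_term ::
    "('a, 'n::finite) chart set \<Rightarrow> ('a, 'n) hform \<Rightarrow> ('a, 'n) chart \<Rightarrow>
      complex^'n \<Rightarrow> complex^'n \<Rightarrow> complex^'n \<Rightarrow> complex" where
  "levi_term A h c z x y = (\<Sum>i\<in>UNIV. \<Sum>j\<in>UNIV. \<Sum>k\<in>UNIV. \<Sum>l\<in>UNIV.
     dz k (dzbar l (\<lambda>w. local_expr A h c w $ i $ j)) z
       * x $ i * cnj (x $ j) * y $ k * cnj (y $ l))"

text \<open>Each of the summation ranges has a type of its own, so that every exchange of two
  neighbouring sums is a terminating rewrite rule.\<close>

lemma sum_swap_4:
  fixes F :: "'a::finite \<Rightarrow> 'b::finite \<Rightarrow> 'c::finite \<Rightarrow> 'd::finite \<Rightarrow> 'e::finite \<Rightarrow> complex"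
  shows "(\<Sum>i\<in>UNIV. \<Sum>j\<in>UNIV. \<Sum>k\<in>UNIV. \<Sum>l\<in>UNIV. \<Sum>s\<in>UNIV. F i j k l s)
    = (\<Sum>s\<in>UNIV. \<Sum>i\<in>UNIV. \<Sum>j\<in>UNIV. \<Sum>k\<in>UNIV. \<Sum>l\<in>UNIV. F i j k l s)"
  by (simp only: sum.swap[where A = "UNIV :: 'd set" and B = "UNIV :: 'e set"]
      sum.swap[where A = "UNIV :: 'c set" and B = "UNIV :: 'e set"]
      sum.swap[where A = "UNIV :: 'b set" and B = "UNIV :: 'e set"]
      sum.swap[where A = "UNIV :: 'a set" and B = "UNIV :: 'e set"])

lemma sum_product_4:
  fixes P :: "'a::finite \<Rightarrow> 'c::finite \<Rightarrow> complex" and R :: "'b::finite \<Rightarrow> 'd::finite \<Rightarrow> complex"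
  shows "(\<Sum>i\<in>UNIV. \<Sum>j\<in>UNIV. \<Sum>k\<in>UNIV. \<Sum>l\<in>UNIV. P i k * R j l)
    = (\<Sum>i\<in>UNIV. \<Sum>k\<in>UNIV. P i k) * (\<Sum>j\<in>UNIV. \<Sum>l\<in>UNIV. R j l)"
  by (simp add: sum_product)

text \<open>Since the antiholomorphic derivative of the metric is the conjugate of the holomorphic one,
  the two first order factors of the curvature are a covector and its conjugate. The hypothesis
  asks for this conjugacy alone, so that for a sum of metrics it can be inherited from the
  summands.\<close>

lemma curvature_decomposition:
  fixes A :: "('a, 'n::finite) chart set"
  assumes herm: "\<And>l s j. dzbar l (\<lambda>w. local_expr A h c w $ s $ j) (snd c p)
    = cnj (dz l (\<lambda>w. local_expr A h c w $ j $ s) (snd c p))"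
  shows "curvature A h c p X X Y Y = - levi_term A h c (snd c p) (X c) (Y c)
    + dual_quad (local_expr A h c (snd c p)) (metric_derivative A h c (snd c p) (X c) (Y c))"
proof -
  let ?z = "snd c p" and ?x = "X c" and ?y = "Y c"
  let ?I = "inverse_metric (local_expr A h c ?z)"
  let ?D = "\<lambda>k i t. dz k (\<lambda>w. local_expr A h c w $ i $ t) ?z"
  let ?L = "\<lambda>i j k l. dz k (dzbar l (\<lambda>w. local_expr A h c w $ i $ j)) ?z
     * ?x $ i * cnj (?x $ j) * ?y $ k * cnj (?y $ l)"
  let ?P = "\<lambda>t i k. ?x $ i * ?y $ k * ?D k i t"
  have coeff: "curv_coeff A h c p i j k l * ?x $ i * cnj (?x $ j) * ?y $ k * cnj (?y $ l)
      = - ?L i j k l + (\<Sum>s\<in>UNIV. \<Sum>t\<in>UNIV. ?I s t * ?P t i k * cnj (?P s j l))" for i j k l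
    unfolding curv_coeff_def Let_def herm
    by (simp add: distrib_right left_diff_distrib right_diff_distrib sum_distrib_right
        sum_distrib_left mult_ac)
  have st: "(\<Sum>i\<in>UNIV. \<Sum>j\<in>UNIV. \<Sum>k\<in>UNIV. \<Sum>l\<in>UNIV. ?I s t * ?P t i k * cnj (?P s j l))
      = ?I s t * metric_derivative A h c ?z ?x ?y $ t
          * cnj (metric_derivative A h c ?z ?x ?y $ s)" for s t
    unfolding sum_product_4
    by (simp only: metric_derivative_def vec_lambda_beta cnj_sum sum_distrib_left)
  have "(\<Sum>i\<in>UNIV. \<Sum>j\<in>UNIV. \<Sum>k\<in>UNIV. \<Sum>l\<in>UNIV. \<Sum>s\<in>UNIV. \<Sum>t\<in>UNIV.
        ?I s t * ?P t i k * cnj (?P s j l))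
      = (\<Sum>s\<in>UNIV. \<Sum>i\<in>UNIV. \<Sum>j\<in>UNIV. \<Sum>k\<in>UNIV. \<Sum>l\<in>UNIV. \<Sum>t\<in>UNIV.
        ?I s t * ?P t i k * cnj (?P s j l))"
    by (rule sum_swap_4)
  also have "\<dots> = (\<Sum>s\<in>UNIV. \<Sum>t\<in>UNIV. \<Sum>i\<in>UNIV. \<Sum>j\<in>UNIV. \<Sum>k\<in>UNIV. \<Sum>l\<in>UNIV.
        ?I s t * ?P t i k * cnj (?P s j l))"
    by (rule sum.cong[OF refl sum_swap_4])
  finally have swap: "(\<Sum>i\<in>UNIV. \<Sum>j\<in>UNIV. \<Sum>k\<in>UNIV. \<Sum>l\<in>UNIV. \<Sum>s\<in>UNIV. \<Sum>t\<in>UNIV.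
        ?I s t * ?P t i k * cnj (?P s j l))
      = (\<Sum>s\<in>UNIV. \<Sum>t\<in>UNIV. ?I s t * metric_derivative A h c ?z ?x ?y $ t
          * cnj (metric_derivative A h c ?z ?x ?y $ s))"
    unfolding st .
  show ?thesis
    unfolding curvature_def coeff sum.distrib sum_negf swap levi_term_def dual_quad_def ..
qed

lemma local_expr_add:
  "local_expr A (add_metric h g) c z = local_expr A h c z + local_expr A g c z"
  by (simp add: local_expr_def add_metric_def vec_eq_iff)

text \<open>Both the Levi term and the covector of first derivatives are additive in the metric; only the
  passage to the inverse metric is not, and there \<open>dual_quad_add_le\<close> applies.\<close>

lemma curvature_add_metric_le:
  fixes M :: "'a topology" and A :: "('a, 'n::finite) chart set"
  assumes M: "complex_manifold M A" and h: "hermitian_metric M A h" and g: "hermitian_metric M A g"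
    and p: "p \<in> topspace M" and c: "c \<in> charts_at A p"
  shows "Re (curvature A (add_metric h g) c p X X Y Y)
    \<le> Re (curvature A h c p X X Y Y) + Re (curvature A g c p X X Y Y)"
proof -
  let ?z = "snd c p" and ?x = "X c" and ?y = "Y c"
  let ?S = "snd c ` fst c"
  have in_A: "c \<in> A" and z: "open ?S" "?z \<in> ?S"
    using c open_chart_image[OF M _ chart_open[OF M]] by (auto simp: charts_at_def)
  note sh = local_expr_smooth[OF M h in_A] and sg = local_expr_smooth[OF M g in_A]
  have "levi_term A (add_metric h g) c ?z ?x ?y = levi_term A h c ?z ?x ?y + levi_term A g c ?z ?x ?y"
    unfolding levi_term_def local_expr_add vector_add_component dz_dzbar_add[OF sh sg z]
    by (simp add: distrib_right sum.distrib)
  moreover have "metric_derivative A (add_metric h g) c ?z ?x ?y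
      = metric_derivative A h c ?z ?x ?y + metric_derivative A g c ?z ?x ?y"
    unfolding metric_derivative_def local_expr_add vector_add_component
      dz_add[OF smooth_on_differentiable[OF sh z(2)] smooth_on_differentiable[OF sg z(2)]]
    by (simp add: vec_eq_iff distrib_left sum.distrib)
  moreover have "dzbar l (\<lambda>w. local_expr A (add_metric h g) c w $ s $ j) ?z
      = cnj (dz l (\<lambda>w. local_expr A (add_metric h g) c w $ j $ s) ?z)" for l s j
    unfolding local_expr_add vector_add_component
      dz_add[OF smooth_on_differentiable[OF sh z(2)] smooth_on_differentiable[OF sg z(2)]]
      dzbar_add[OF smooth_on_differentiable[OF sh z(2)] smooth_on_differentiable[OF sg z(2)]]
      dzbar_local_expr[OF M h p c] dzbar_local_expr[OF M g p c] by simp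
  ultimately show ?thesis
    using dual_quad_add_le[OF positive_hermitian_local_expr[OF M h p c]
        positive_hermitian_local_expr[OF M g p c]]
    by (simp add: curvature_decomposition curvature_decomposition[OF dzbar_local_expr[OF M h p c]]
        curvature_decomposition[OF dzbar_local_expr[OF M g p c]] local_expr_add)
qed

section \<open>Spherical comparison\<close>

text \<open>The infimum is over unit vectors; a nonzero \<open>X\<close> is compared with it after division by its
  norm. The existence of \<open>X\<close> also makes the unit sphere nonempty, without which the infimum would
  be an arbitrary real number of unknown sign.\<close>

lemma spherical_comparison_bounds:
  fixes M :: "'a topology" and A :: "('a, 'n::finite) chart set"
  assumes M: "complex_manifold M A" and h: "hermitian_metric M A h" and g: "hermitian_metric M A g"
    and p: "p \<in> topspace M" and c: "c \<in> charts_at A p"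
    and X: "X \<in> tangent_space A p" "X \<noteq> zero_tangent"
  shows "0 \<le> spherical_comparison M A h g"
    and "spherical_comparison M A h g * (Re (h p X X) + Re (g p X X)) \<le> Re (h p X X)"
proof -
  let ?S = "sphere_bundle M A (add_metric h g)"
  let ?N = "Re (h p X X) + Re (g p X X)"
  have N: "0 < ?N"
    using hermitian_metric_pos[OF h p X(1) X] hermitian_metric_pos[OF g p X(1) X] by simp
  define a where "a = complex_of_real (1 / sqrt ?N)"
  let ?U = "scale_tangent a X"
  have U: "?U \<in> tangent_space A p"
    by (rule scale_tangent_in_tangent_space[OF M c X(1)])
  have scale: "f p ?U ?U = complex_of_real (1 / ?N) * f p X X" if f: "hermitian_metric M A f" for f
  proof -
    have "f p ?U ?U = a * f p X ?U"
      by (rule hermitian_metric_scale[OF f p X(1) U])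
    also have "f p X ?U = cnj (f p ?U X)"
      by (rule hermitian_metric_commute[OF f p U X(1)])
    also have "f p ?U X = a * f p X X"
      by (rule hermitian_metric_scale[OF f p X(1) X(1)])
    also have "a * cnj (a * f p X X) = a * cnj a * f p X X"
      using hermitian_metric_commute[OF f p X(1) X(1)] by simp
    also have "a * cnj a = complex_of_real (1 / ?N)"
      using N unfolding a_def complex_cnj_complex_of_real of_real_mult[symmetric]
      by (simp add: field_simps)
    finally show ?thesis .
  qed
  have "hnorm (add_metric h g) p ?U = 1"
    using N by (simp add: hnorm_def add_metric_def scale[OF h] scale[OF g]
        flip: distrib_left add_divide_distrib)
  then have mem: "(p, ?U) \<in> ?S"
    using p U by (simp add: sphere_bundle_def)
  then show "0 \<le> spherical_comparison M A h g"
    unfolding spherical_comparison_def by (intro cINF_greatest) auto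
  have "bdd_below ((\<lambda>(p, X). (hnorm h p X)\<^sup>2) ` ?S)"
    by (rule bdd_belowI[of _ 0]) auto
  then have "spherical_comparison M A h g \<le> (hnorm h p ?U)\<^sup>2"
    unfolding spherical_comparison_def
    using cINF_lower[OF _ mem, of "\<lambda>(p, X). (hnorm h p X)\<^sup>2"] by simp
  also have "\<dots> = Re (h p X X) / ?N"
    using N h p X by (simp add: hnorm_def scale[OF h] hermitian_metric_pos[OF h p X(1) X] less_imp_le)
  finally show "spherical_comparison M A h g * ?N \<le> Re (h p X X)"
    using N by (simp add: pos_le_divide_eq)
qed

theorem theorem3p2:
  fixes M :: "'a topology" and A :: "('a, 'n::finite) chart set"
    and g h :: "('a, 'n) hform" and B1 B2 :: real
  assumes "complex_manifold M A"
    and "hermitian_metric M A g"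
    and "hermitian_metric M A h"
    and "B1 > 0" and "B2 > 0"
    and "HBC_le M A g (- B1)"
    and "HBC_le M A h (- B2)"
  shows "HBC_le M A (add_metric h g)
    (- ((spherical_comparison M A g h)\<^sup>2 * B1) - (spherical_comparison M A h g)\<^sup>2 * B2)"
proof -
  note M = assms(1) and g = assms(2) and h = assms(3)
  let ?Cg = "spherical_comparison M A g h" and ?Ch = "spherical_comparison M A h g"
  show ?thesis
    unfolding HBC_le_def
  proof (intro ballI impI)
    fix p c X Y
    assume p: "p \<in> topspace M" and c: "c \<in> charts_at A p"
      and X: "X \<in> tangent_space A p" "X \<noteq> zero_tangent"
      and Y: "Y \<in> tangent_space A p" "Y \<noteq> zero_tangent"
    define hX hY gX gY where "hX = Re (h p X X)" and "hY = Re (h p Y Y)"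
      and "gX = Re (g p X X)" and "gY = Re (g p Y Y)"
    have pos: "0 < hX" "0 < hY" "0 < gX" "0 < gY"
      unfolding hX_def hY_def gX_def gY_def
      using hermitian_metric_pos[OF h p X(1) X] hermitian_metric_pos[OF h p Y(1) Y]
        hermitian_metric_pos[OF g p X(1) X] hermitian_metric_pos[OF g p Y(1) Y] by blast+
    have "HBC A g c p X Y \<le> - B1" "HBC A h c p X Y \<le> - B2"
      using assms(6,7) p c X Y unfolding HBC_le_def by blast+
    then have Rg: "Re (curvature A g c p X X Y Y) \<le> - B1 * (gX * gY)"
      and Rh: "Re (curvature A h c p X X Y Y) \<le> - B2 * (hX * hY)"
      using pos by (simp_all add: HBC_def hX_def hY_def gX_def gY_def pos_divide_le_eq)
    note Ch = spherical_comparison_bounds[OF M h g p c, folded hX_def hY_def gX_def gY_def]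
    note Cg = spherical_comparison_bounds[OF M g h p c, folded hX_def hY_def gX_def gY_def]
    have "(?Cg * (gX + hX)) * (?Cg * (gY + hY)) \<le> gX * gY"
      using Cg[OF X] Cg[OF Y] pos
      by (intro mult_mono) (auto simp: gX_def hX_def gY_def hY_def)
    moreover have "(?Ch * (hX + gX)) * (?Ch * (hY + gY)) \<le> hX * hY"
      using Ch[OF X] Ch[OF Y] pos
      by (intro mult_mono) (auto simp: gX_def hX_def gY_def hY_def)
    ultimately have "B1 * ((?Cg * (gX + hX)) * (?Cg * (gY + hY)))
        + B2 * ((?Ch * (hX + gX)) * (?Ch * (hY + gY))) \<le> B1 * (gX * gY) + B2 * (hX * hY)"
      using assms(4,5) by (intro add_mono mult_left_mono) simp_all
    then have "Re (curvature A (add_metric h g) c p X X Y Y)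
        \<le> (- (?Cg\<^sup>2 * B1) - ?Ch\<^sup>2 * B2) * ((hX + gX) * (hY + gY))"
      using Rg Rh curvature_add_metric_le[OF M h g p c, of X Y]
      by (simp add: algebra_simps power2_eq_square)
    moreover have "0 < (hX + gX) * (hY + gY)"
      using pos by simp
    ultimately show "HBC A (add_metric h g) c p X Y \<le> - (?Cg\<^sup>2 * B1) - ?Ch\<^sup>2 * B2"
      by (simp add: HBC_def add_metric_def pos_divide_le_eq hX_def hY_def gX_def gY_def)
  qed
qed

end
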